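(* Let $H$ be a graph which has a vertex whose removal makes the graph acyclic, and suppose there are constants $\alpha$ and $C>0$ such that the Turán number of $H$ satisfies $\mathrm{ex}(n,H)\leq C n^{1+\alpha}$ for all positive integers $n$. Then there exists a constant $c>0$ (depending on $H$) such that for every positive integer $m$, $$\mathrm{sp}(m,H)\geq c\, m^{\frac{\alpha+2}{2\alpha+2}}.$$
   Context: All graphs are finite and simple. For a graph $G$, $\mathrm{mc}(G)$ is the maximum number of edges of a bipartite subgraph of $G$, and the surplus of $G$ is $\mathrm{sp}(G)=\mathrm{mc}(G)-e(G)/2$, where $e(G)$ is the number of edges. A graph is $H$-free if it contains no (not necessarily induced) subgraph isomorphic to $H$. For a positive integer $m$, $\mathrm{sp}(m,H)$ is the minimum of $\mathrm{sp}(G)$ over all $H$-free graphs $G$ with exactly $m$ edges. The Turán number $\mathrm{ex}(n,H)$ is the maximum number of edges of an $H$-free graph on $n$ vertices. *)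

theory Defs
  imports Complex_Main "HOL-Library.Extended_Real"
begin

record 'a graph =
  verts :: "'a set"
  edges :: "'a set set"

definition fin_simple_graph :: "'a graph \<Rightarrow> bool" where
  "fin_simple_graph G \<longleftrightarrow>
     finite (verts G) \<and> (\<forall>e\<in>edges G. e \<subseteq> verts G \<and> card e = 2)"

definition subgraph :: "'a graph \<Rightarrow> 'a graph \<Rightarrow> bool" where
  "subgraph G' G \<longleftrightarrow>
     fin_simple_graph G' \<and> verts G' \<subseteq> verts G \<and> edges G' \<subseteq> edges G"

definition graph_iso :: "'a graph \<Rightarrow> 'b graph \<Rightarrow> bool" where
  "graph_iso G K \<longleftrightarrow>
     (\<exists>f. bij_betw f (verts G) (verts K) \<and>
          (\<forall>u\<in>verts G. \<forall>v\<in>verts G. {u, v} \<in> edges G \<longleftrightarrow> {f u, f v} \<in> edges K))"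

definition graph_free :: "'a graph \<Rightarrow> 'b graph \<Rightarrow> bool" where
  "graph_free H G \<longleftrightarrow> \<not> (\<exists>G'. subgraph G' G \<and> graph_iso H G')"

definition delete_vertex :: "'a graph \<Rightarrow> 'a \<Rightarrow> 'a graph" where
  "delete_vertex G v = \<lparr>verts = verts G - {v}, edges = {e \<in> edges G. v \<notin> e}\<rparr>"

text \<open>A cycle is given by the cyclic sequence of its pairwise distinct vertices.\<close>

definition is_cycle :: "'a graph \<Rightarrow> 'a list \<Rightarrow> bool" where
  "is_cycle G xs \<longleftrightarrow>
     3 \<le> length xs \<and> distinct xs \<and> set xs \<subseteq> verts G \<and>
     (\<forall>i<length xs. {xs ! i, xs ! (Suc i mod length xs)} \<in> edges G)"

definition acyclic_graph :: "'a graph \<Rightarrow> bool" where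
  "acyclic_graph G \<longleftrightarrow> \<not> (\<exists>xs. is_cycle G xs)"

definition bipartite :: "'a graph \<Rightarrow> bool" where
  "bipartite G \<longleftrightarrow>
     (\<exists>A B. A \<union> B = verts G \<and> A \<inter> B = {} \<and>
            (\<forall>e\<in>edges G. \<exists>a\<in>A. \<exists>b\<in>B. e = {a, b}))"

definition mc :: "'a graph \<Rightarrow> nat" where
  "mc G = Max {card (edges B) | B. subgraph B G \<and> bipartite B}"

definition surplus :: "'a graph \<Rightarrow> real" where
  "surplus G = real (mc G) - real (card (edges G)) / 2"

text \<open>
  Every finite graph is isomorphic to one whose vertices are natural numbers, so the two
  extremal quantities below range over graphs with vertices in \<^typ>\<open>nat\<close>.

  If \<open>H\<close> has no edges and at most \<open>n\<close> vertices, then no graph on \<open>n\<close> vertices is \<open>H\<close>-free,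
  and \<open>turan_ex n H\<close> is \<open>0\<close>. In all other cases the supremum is over a finite nonempty set.
\<close>

definition turan_ex :: "nat \<Rightarrow> 'a graph \<Rightarrow> nat" where
  "turan_ex n H =
     Sup {card (edges G) | G :: nat graph.
            fin_simple_graph G \<and> graph_free H G \<and> card (verts G) = n}"

text \<open>
  The infimum is taken in the extended reals so that it is \<open>\<infinity>\<close> when there is no \<open>H\<close>-free
  graph with \<open>m\<close> edges (for example, if \<open>H\<close> is a single edge and \<open>m > 0\<close>). Otherwise
  it is a minimum, see \<open>surplus_min_attained\<close>.
\<close>

definition surplus_min :: "nat \<Rightarrow> 'a graph \<Rightarrow> ereal" where
  "surplus_min m H =
     Inf {ereal (surplus G) | G :: nat graph.
            fin_simple_graph G \<and> graph_free H G \<and> card (edges G) = m}"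

lemma surplus_min_attained:
  fixes G :: "nat graph"
  assumes "fin_simple_graph G" "graph_free H G" "card (edges G) = m"
  shows "\<exists>G :: nat graph. fin_simple_graph G \<and> graph_free H G \<and> card (edges G) = m \<and>
           surplus_min m H = ereal (surplus G)"
proof -
  let ?P = "\<lambda>G :: nat graph. fin_simple_graph G \<and> graph_free H G \<and> card (edges G) = m"
  have "?P G" using assms by blast
  from ex_has_least_nat[of ?P, OF this, of mc]
  obtain K where K: "?P K" and least: "\<And>L. ?P L \<Longrightarrow> mc K \<le> mc L" by blast
  have "surplus_min m H = ereal (surplus K)"
    unfolding surplus_min_def
  proof (rule antisym)
    show "Inf {ereal (surplus G) | G. ?P G} \<le> ereal (surplus K)"
      using K by (intro Inf_lower) blast
    show "ereal (surplus K) \<le> Inf {ereal (surplus G) | G. ?P G}"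
    proof (rule Inf_greatest)
      fix x assume "x \<in> {ereal (surplus G) | G. ?P G}"
      then obtain L where L: "?P L" "x = ereal (surplus L)" by blast
      then show "ereal (surplus K) \<le> x"
        using K least[of L] by (simp add: surplus_def)
    qed
  qed
  with K show ?thesis by blast
qed

end

theory Submission
  imports Defs "HOL-Library.FuncSet"
begin

text \<open>
  Let \<open>G\<close> be \<open>H\<close>-free with \<open>m\<close> edges. Applying the Turan bound to a subgraph of minimum degree \<open>\<delta>\<close>
  with at most \<open>2m/\<delta>\<close> vertices shows that \<open>G\<close> is \<open>D\<close>-degenerate with \<open>D = O(m powr (\<alpha> / (1 + \<alpha>)))\<close>,
  so it suffices to find a cut of surplus of order \<open>m / sqrt D\<close>. Orient the edges so that the
  in-neighbourhoods \<open>B v\<close> have size at most \<open>D\<close>, take independent random signs \<open>r\<close>, and put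
  \<open>y v = (1 - p) r v - p sin (\<theta> \<Sum>u\<in>B v. r u)\<close> with \<open>\<theta> = 1 / (2 sqrt D)\<close> and a small constant \<open>p\<close>.
  On an edge \<open>(u, v)\<close> the expectation of \<open>y u * y v\<close> has a term of order \<open>- p \<theta>\<close>, because \<open>v\<close> votes
  against \<open>u\<close>, and an error of at most \<open>p\<^sup>2 \<theta>\<^sup>2 |B u \<inter> B v|\<close>. The errors sum to \<open>p\<^sup>2 \<theta>\<^sup>2\<close> times
  the number of triangles, which is \<open>O(m)\<close>: a neighbourhood contains no copy of the forest obtained
  from \<open>H\<close> by deleting a vertex, hence has linearly many edges. Finally \<open>y\<close> can be rounded to signs,
  since the sum over edges is multilinear. The sine makes all expectations products of cosines.
\<close>

section \<open>Rounding correlated random signs\<close>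

text \<open>The exponential of a linear form is a product over the coordinates, so the sum over sign
  vectors factors. Each factor is \<open>cis (a w) + cis (- a w)\<close>, which is real.\<close>

lemma sum_sign_cis:
  fixes a :: "'a \<Rightarrow> real"
  assumes "finite V"
  shows "(\<Sum>r\<in>V \<rightarrow>\<^sub>E {-1, 1}. cis (\<Sum>w\<in>V. a w * r w)) = of_real (\<Prod>w\<in>V. 2 * cos (a w))"
proof -
  have cis_sum: "cis (\<Sum>w\<in>W. g w) = (\<Prod>w\<in>W. cis (g w))" for g :: "'a \<Rightarrow> real" and W
    by (induction W rule: infinite_finite_induct) (simp_all flip: cis_mult)
  have "(\<Sum>r\<in>V \<rightarrow>\<^sub>E {-1, 1}. cis (\<Sum>w\<in>V. a w * r w))
      = (\<Sum>r\<in>V \<rightarrow>\<^sub>E {-1, 1}. \<Prod>w\<in>V. cis (a w * r w))"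
    by (simp add: cis_sum)
  also have "\<dots> = (\<Prod>w\<in>V. \<Sum>t\<in>{-1, 1}. cis (a w * t))"
    using assms by (subst prod_sum_PiE) auto
  also have "\<dots> = (\<Prod>w\<in>V. of_real (2 * cos (a w)))"
    by (intro prod.cong) (auto simp: complex_eq_iff)
  finally show ?thesis by simp
qed

lemma sum_sign_cos:
  fixes a :: "'a \<Rightarrow> real"
  assumes "finite V"
  shows "(\<Sum>r\<in>V \<rightarrow>\<^sub>E {-1, 1}. cos (\<Sum>w\<in>V. a w * r w)) = 2 ^ card V * (\<Prod>w\<in>V. cos (a w))"
  using arg_cong[OF sum_sign_cis[OF assms, of a], of Re]
  unfolding Re_complex_of_real by (simp add: prod.distrib)

lemma sum_sign_sin_sin:
  fixes a b :: "'a \<Rightarrow> real"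
  assumes "finite V"
  shows "(\<Sum>r\<in>V \<rightarrow>\<^sub>E {-1, 1}. sin (\<Sum>w\<in>V. a w * r w) * sin (\<Sum>w\<in>V. b w * r w))
    = 2 ^ card V * (((\<Prod>w\<in>V. cos (a w - b w)) - (\<Prod>w\<in>V. cos (a w + b w))) / 2)"
proof -
  have *: "sin (\<Sum>w\<in>V. a w * r w) * sin (\<Sum>w\<in>V. b w * r w)
     = (cos (\<Sum>w\<in>V. (a w - b w) * r w) - cos (\<Sum>w\<in>V. (a w + b w) * r w)) / 2" for r :: "'a \<Rightarrow> real"
    by (simp add: sin_times_sin sum_subtractf sum.distrib algebra_simps)
  show ?thesis
    by (simp only: * sum_divide_distrib[symmetric] sum_subtractf sum_sign_cos[OF assms]) (simp add: right_diff_distrib)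
qed

text \<open>The sum is affine in each coordinate of \<open>y\<close>, so coordinates can be moved to \<open>\<plusminus>1\<close> one at a time.\<close>
lemma round_to_signs:
  fixes y :: "'a \<Rightarrow> real"
  assumes "finite A" and loopless: "\<And>u v. (u, v) \<in> A \<Longrightarrow> u \<noteq> v"
    and "finite V" "\<And>v. v \<in> V \<Longrightarrow> \<bar>y v\<bar> \<le> 1"
  shows "\<exists>s. (\<forall>v\<in>V. s v \<in> {-1, 1}) \<and> (\<Sum>(u, v)\<in>A. s u * s v) \<le> (\<Sum>(u, v)\<in>A. y u * y v)"
proof -
  define f where "f z = (\<Sum>(u, v)\<in>A. z u * z v)" for z :: "'a \<Rightarrow> real"
  \<comment> \<open>Agreement with \<open>y\<close> off \<open>V\<close> is carried along so that
    the next coordinate to be moved still lies between -1 and 1.\<close>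
  have "\<exists>s. (\<forall>v\<in>V. s v \<in> {-1, 1}) \<and> (\<forall>v. v \<notin> V \<longrightarrow> s v = y v) \<and> f s \<le> f y"
    using assms(3,4)
  proof (induction V rule: finite_induct)
    case empty
    then show ?case by auto
  next
    case (insert x V)
    then obtain s where s: "\<forall>v\<in>V. s v \<in> {-1, 1}" "\<forall>v. v \<notin> V \<longrightarrow> s v = y v" "f s \<le> f y"
      by auto
    let ?t = "s x"
    have x: "\<bar>?t\<bar> \<le> 1" using insert s by auto
    \<comment> \<open>No pair \<open>(x, x)\<close> occurs, so \<open>f\<close> is affine in
      coordinate \<open>x\<close>; hence \<open>f s\<close> is a convex combination of its values at
      the two endpoints, and one of them is no larger.\<close>
    have "f s = (1 + ?t) / 2 * f (s(x := 1)) + (1 - ?t) / 2 * f (s(x := -1))"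
      unfolding f_def sum_distrib_left sum.distrib[symmetric]
      by (rule sum.cong) (auto dest: loopless simp: field_simps)
    moreover have "(1 + ?t) / 2 * min (f (s(x := 1))) (f (s(x := -1))) \<le> (1 + ?t) / 2 * f (s(x := 1))"
      "(1 - ?t) / 2 * min (f (s(x := 1))) (f (s(x := -1))) \<le> (1 - ?t) / 2 * f (s(x := -1))"
      using x by (intro mult_left_mono; simp)+
    ultimately have "min (f (s(x := 1))) (f (s(x := -1))) \<le> f s"
      by (simp add: field_simps)
    then obtain c where "c = 1 \<or> c = -1" "f (s(x := c)) \<le> f s"
      by (metis min_le_iff_disj)
    then show ?case
      using s insert.hyps by (intro exI[of _ "s(x := c)"]) (auto simp del: fun_upd_apply simp: fun_upd_def[of s x c] intro: order_trans)
  qed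
  then show ?thesis by (auto simp: f_def)
qed

section \<open>Trigonometric estimates for the correlations\<close>

lemma sin_ge_half:
  fixes x :: real
  assumes "0 \<le> x" "x \<le> 1"
  shows "x / 2 \<le> sin x"
proof -
  have "\<bar>sin x - x\<bar> \<le> inverse (fact 3) * \<bar>x\<bar> ^ 3"
    using Maclaurin_sin_bound[of x 3] by (simp add: sin_coeff_def numeral_eq_Suc)
  moreover have "x ^ 3 \<le> x"
    using assms power_decreasing[of 1 3 x] by simp
  ultimately show ?thesis using assms by (simp add: fact_numeral abs_if split: if_splits)
qed

lemma cos_ge_quadratic: "1 - x\<^sup>2 / 2 \<le> cos (x::real)"
proof -
  have "(sin (x / 2))\<^sup>2 \<le> (x / 2)\<^sup>2"
    using abs_sin_x_le_abs_x[of "x / 2"] by (simp only: abs_le_square_iff)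
  then show ?thesis
    using cos_double_sin[of "x / 2"] by (simp add: power_divide)
qed

text \<open>This controls the correlation between two votes. The two products differ only on
  \<open>B \<inter> B'\<close>, where the first has factors 1 and the second has factors
  \<open>cos (2 * \<theta>)\<close>; Bernoulli's inequality bounds the loss.\<close>

lemma prod_cos_diff_add_le:
  fixes \<theta> :: real
  assumes "finite V" "B \<subseteq> V" "B' \<subseteq> V" and \<theta>: "0 \<le> \<theta>" "\<theta> \<le> 1 / 2"
  shows "(\<Prod>w\<in>V. cos ((if w \<in> B then \<theta> else 0) - (if w \<in> B' then \<theta> else 0)))
       - (\<Prod>w\<in>V. cos ((if w \<in> B then \<theta> else 0) + (if w \<in> B' then \<theta> else 0)))
       \<le> 2 * card (B \<inter> B') * \<theta>\<^sup>2"
    (is "?P - ?Q \<le> _")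
proof -
  let ?n = "card (B \<inter> B')"
  have cosp: "0 \<le> cos \<theta>" using cos_ge_quadratic[of \<theta>] power_le_one[of \<theta> 2] \<theta> by simp
  have P: "0 \<le> ?P" "?P \<le> 1" using cosp by (auto intro!: prod_nonneg prod_le_1)
  have "cos ((if w \<in> B then \<theta> else 0) + (if w \<in> B' then \<theta> else 0))
      = cos ((if w \<in> B then \<theta> else 0) - (if w \<in> B' then \<theta> else 0))
        * (if w \<in> B \<inter> B' then cos (2 * \<theta>) else 1)" for w
    by auto
  then have "?Q = ?P * (\<Prod>w\<in>V. if w \<in> B \<inter> B' then cos (2 * \<theta>) else 1)"
    by (simp only: prod.distrib)
  also have "(\<Prod>w\<in>V. if w \<in> B \<inter> B' then cos (2 * \<theta>) else 1) = (\<Prod>w\<in>B \<inter> B'. cos (2 * \<theta>))"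
    using assms by (intro prod.mono_neutral_cong_right) auto
  finally have Q: "?Q = ?P * cos (2 * \<theta>) ^ ?n" by simp
  have sq: "\<theta>\<^sup>2 \<le> 1 / 4" using power_mono[OF \<theta>(2,1), of 2] by (simp add: power2_eq_square)
  have c: "1 - 2 * \<theta>\<^sup>2 \<le> cos (2 * \<theta>)" using cos_ge_quadratic[of "2 * \<theta>"] by (simp add: power_mult_distrib)
  have "1 + ?n * (- 2 * \<theta>\<^sup>2) \<le> (1 + (- 2 * \<theta>\<^sup>2)) ^ ?n"
    using sq by (intro Bernoulli_inequality) simp
  also have "\<dots> \<le> cos (2 * \<theta>) ^ ?n" using c sq by (intro power_mono) simp_all
  finally have "1 - cos (2 * \<theta>) ^ ?n \<le> 2 * ?n * \<theta>\<^sup>2" by simp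
  moreover have "?P * (1 - cos (2 * \<theta>) ^ ?n) \<le> 1 * (1 - cos (2 * \<theta>) ^ ?n)"
    using P by (intro mult_right_mono) (use c sq in \<open>simp_all add: power_le_one\<close>)
  ultimately show ?thesis unfolding Q by (simp add: algebra_simps)
qed

text \<open>This is the gain from a vote against \<open>u\<close>. The shift by
  \<open>pi / 2\<close> turns the factor at \<open>u\<close> into plus or minus
  \<open>sin \<theta>\<close>, so the difference is
  \<open>2 * sin \<theta> * cos \<theta> ^ (card B - 1)\<close>. The bound on
  \<open>real D * \<theta>\<^sup>2\<close> keeps the cosine power above 1/2.\<close>

lemma prod_cos_indicator_ge:
  fixes \<theta> :: real
  assumes "finite V" "B \<subseteq> V" "u \<in> B" "card B \<le> D" and \<theta>: "0 \<le> \<theta>" "real D * \<theta>\<^sup>2 \<le> 1 / 4" "\<theta> \<le> 1"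
  shows "\<theta> / 2 \<le> (\<Prod>w\<in>V. cos ((if w = u then pi / 2 else 0) - (if w \<in> B then \<theta> else 0)))
       - (\<Prod>w\<in>V. cos ((if w = u then pi / 2 else 0) + (if w \<in> B then \<theta> else 0)))"
    (is "_ \<le> ?P - ?Q")
proof -
  have fin: "finite B" using assms finite_subset by blast
  have *: "(\<Prod>w\<in>V. cos ((if w = u then pi / 2 else 0) + (if w \<in> B then t else 0)))
      = - sin t * cos t ^ (card B - 1)" for t :: real
  proof -
    have "(\<Prod>w\<in>V. cos ((if w = u then pi / 2 else 0) + (if w \<in> B then t else 0)))
      = (\<Prod>w\<in>insert u (B - {u}). cos ((if w = u then pi / 2 else 0) + (if w \<in> B then t else 0)))"
      using assms by (intro prod.mono_neutral_right) auto
    also have "\<dots> = cos (pi / 2 + t) * (\<Prod>w\<in>B - {u}. cos t)"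
      using assms fin by (subst prod.insert) (auto intro!: prod.cong)
    finally show ?thesis using assms fin by (simp add: cos_add)
  qed
  have Q: "?Q = - sin \<theta> * cos \<theta> ^ (card B - 1)" by (rule *)
  have "?P = (\<Prod>w\<in>V. cos ((if w = u then pi / 2 else 0) + (if w \<in> B then - \<theta> else 0)))"
    by (intro prod.cong) auto
  then have P: "?P = sin \<theta> * cos \<theta> ^ (card B - 1)" using *[of "- \<theta>"] by simp
  have sq: "\<theta>\<^sup>2 \<le> 1" using \<theta> by (simp add: power_le_one)
  have "1 / 2 \<le> 1 - real D * \<theta>\<^sup>2 / 2" using \<theta> by simp
  also have "\<dots> \<le> 1 + real (card B - 1) * (- \<theta>\<^sup>2 / 2)"
    using assms mult_right_mono[of "real (card B - 1)" "real D" "\<theta>\<^sup>2"] by simp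
  also have "\<dots> \<le> (1 + (- \<theta>\<^sup>2 / 2)) ^ (card B - 1)"
    using sq by (intro Bernoulli_inequality) simp
  also have "\<dots> \<le> cos \<theta> ^ (card B - 1)"
    using cos_ge_quadratic[of \<theta>] sq by (intro power_mono) simp_all
  finally have "\<theta> / 2 * (1 / 2) \<le> sin \<theta> * cos \<theta> ^ (card B - 1)"
    using sin_ge_half[of \<theta>] \<theta> by (intro mult_mono) simp_all
  then show ?thesis unfolding P Q by simp
qed

lemma exists_negatively_correlated_signs:
  fixes A :: "('a \<times> 'a) set" and D K :: nat
  assumes "finite V" "A \<subseteq> V \<times> V" and asym: "\<And>u v. (u, v) \<in> A \<Longrightarrow> (v, u) \<notin> A"
    and indegree: "\<And>v. v \<in> V \<Longrightarrow> card {u. (u, v) \<in> A} \<le> D" and "D \<ge> 1"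
    and sparse: "\<And>w. w \<in> V \<Longrightarrow>
      card {(u, v). (u, v) \<in> A \<and> (w, u) \<in> A \<and> (w, v) \<in> A} \<le> K * card {v. (w, v) \<in> A}"
  shows "\<exists>s. (\<forall>v\<in>V. s v \<in> {-1, 1}) \<and>
    (\<Sum>(u, v)\<in>A. s u * s v) \<le> - (real (card A) / (128 * (real K + 1) * sqrt D))"
proof -
  define R where "R = (V \<rightarrow>\<^sub>E {-1, 1 :: real})"
  \<comment> \<open>The largest angle with \<open>real D * \<theta>\<^sup>2 \<le> 1 / 4\<close>, the
    condition in \<open>prod_cos_indicator_ge\<close>.\<close>
  define \<theta> where "\<theta> = 1 / (2 * sqrt D)"
  \<comment> \<open>The gain is linear in \<open>p\<close> and the triangle error quadratic; this
    choice gives \<open>p * real K \<le> 1 / 4\<close>, so that the gain dominates.\<close>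
  define p where "p = 1 / (4 * (real K + 1))"
  define B where "B v = {u. (u, v) \<in> A}" for v
  define e where "e v w = (if w = v then pi / 2 else 0 :: real)" for v w :: 'a
  define a where "a v w = (if w \<in> B v then \<theta> else 0)" for v w
  define S where "S f g = ((\<Prod>w\<in>V. cos (f w - g w)) - (\<Prod>w\<in>V. cos (f w + g w))) / 2" for f g :: "'a \<Rightarrow> real"
  define l where "l f r = (\<Sum>w\<in>V. f w * r w)" for f r :: "'a \<Rightarrow> real"
  define y where "y r v = (1 - p) * sin (l (e v) r) - p * sin (l (a v) r)" for r v
  \<comment> \<open>\<open>sin (l (e v) r)\<close> is just \<open>r v\<close>; written this way, every correlation below is an
    instance of \<open>sum_sign_sin_sin\<close>.\<close>
  have finA: "finite A" using assms finite_subset[OF _ finite_cartesian_product] by blast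
  have finB: "finite (B v)" "B v \<subseteq> V" for v using assms finite_subset[of "B v" V] by (auto simp: B_def)
  have \<theta>: "0 < \<theta>" "\<theta> \<le> 1 / 2" "real D * \<theta>\<^sup>2 = 1 / 4"
    using \<open>D \<ge> 1\<close> by (auto simp: \<theta>_def power_divide power_mult_distrib divide_simps)
  have p: "0 < p" "p \<le> 1 / 4" "p * real K \<le> 1 / 4" by (auto simp: p_def field_simps)
  have finR: "finite R" and cardR: "card R = 2 ^ card V"
    unfolding R_def using assms by (auto intro!: finite_PiE simp: card_PiE numeral_eq_Suc)
  have E: "(\<Sum>r\<in>R. sin (l f r) * sin (l g r)) = card R * S f g" for f g
    using sum_sign_sin_sin[OF \<open>finite V\<close>, of f g] unfolding R_def[symmetric] l_def S_def cardR by simp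
  have vanish: "(\<Prod>w\<in>V. cos (f w)) = 0" if "x \<in> V" "f x = pi / 2 \<or> f x = - (pi / 2)" for f x
  proof -
    have "cos (f x) = 0" using that(2) by (elim disjE) (simp_all only: cos_minus cos_pi_half)
    then show ?thesis using that(1) \<open>finite V\<close> by (auto intro!: bexI[of _ x])
  qed
  have edge: "(\<Sum>r\<in>R. y r u * y r v) \<le> card R * (p\<^sup>2 * card (B u \<inter> B v) * \<theta>\<^sup>2 - p * (1 - p) * \<theta> / 4)"
    if uv: "(u, v) \<in> A" for u v
  proof -
    have V: "u \<in> V" "v \<in> V" "u \<noteq> v" "u \<in> B v" "v \<notin> B u" using uv assms by (auto simp: B_def)
    \<comment> \<open>Distinct signs are uncorrelated, and the sign of \<open>v\<close> does not
      enter the vote of \<open>u\<close> because \<open>(v, u)\<close> is not in \<open>A\<close>.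
      Of the two mixed terms only the vote of \<open>v\<close> against \<open>u\<close>
      survives.\<close>
    have 1: "S (e u) (e v) = 0" using V vanish[of u] by (simp add: S_def e_def)
    have 2: "S (a u) (e v) = 0" using V vanish[of v] by (simp add: S_def e_def a_def)
    have 3: "\<theta> / 4 \<le> S (e u) (a v)"
      using prod_cos_indicator_ge[OF \<open>finite V\<close> finB(2) V(4) indegree[OF V(2), folded B_def], of \<theta>] \<theta>
      by (simp add: S_def e_def a_def)
    have 4: "S (a u) (a v) \<le> card (B u \<inter> B v) * \<theta>\<^sup>2"
      using prod_cos_diff_add_le[OF \<open>finite V\<close> finB(2) finB(2), of \<theta> u v] \<theta>
      by (simp add: S_def a_def)
    have "(\<Sum>r\<in>R. y r u * y r v) = (1 - p)\<^sup>2 * (\<Sum>r\<in>R. sin (l (e u) r) * sin (l (e v) r))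
       - p * (1 - p) * (\<Sum>r\<in>R. sin (l (e u) r) * sin (l (a v) r))
       - p * (1 - p) * (\<Sum>r\<in>R. sin (l (a u) r) * sin (l (e v) r))
       + p\<^sup>2 * (\<Sum>r\<in>R. sin (l (a u) r) * sin (l (a v) r))"
      unfolding sum_distrib_left sum_subtractf[symmetric] sum.distrib[symmetric]
      by (intro sum.cong) (auto simp: y_def power2_eq_square algebra_simps)
    also have "\<dots> = card R * (p\<^sup>2 * S (a u) (a v) - p * (1 - p) * S (e u) (a v))"
      by (simp only: E 1 2) (simp add: algebra_simps)
    also have "\<dots> \<le> card R * (p\<^sup>2 * (card (B u \<inter> B v) * \<theta>\<^sup>2) - p * (1 - p) * (\<theta> / 4))"
      using 3 4 p by (intro mult_left_mono diff_mono) auto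
    finally show ?thesis by (simp add: mult.assoc)
  qed
  \<comment> \<open>Double counting: a common in-neighbour \<open>w\<close> of the ends of an edge
    corresponds to an edge inside the out-neighbourhood of \<open>w\<close>, and
    \<open>sparse\<close> bounds the number of those.\<close>
  have triangles: "(\<Sum>(u, v)\<in>A. card (B u \<inter> B v)) \<le> K * card A"
  proof -
    have "(\<Sum>(u, v)\<in>A. card (B u \<inter> B v))
        = (\<Sum>uv\<in>A. \<Sum>w\<in>V. if (w, fst uv) \<in> A \<and> (w, snd uv) \<in> A then 1 else 0)"
    proof (intro sum.cong refl, clarify)
      fix u v
      have "B u \<inter> B v = {w\<in>V. (w, u) \<in> A \<and> (w, v) \<in> A}" using assms by (auto simp: B_def)
      then show "card (B u \<inter> B v)
        = (\<Sum>w\<in>V. if (w, fst (u, v)) \<in> A \<and> (w, snd (u, v)) \<in> A then 1 else 0)"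
        using \<open>finite V\<close> by (simp flip: sum.inter_filter)
    qed
    also have "\<dots> = (\<Sum>w\<in>V. \<Sum>uv\<in>A. if (w, fst uv) \<in> A \<and> (w, snd uv) \<in> A then 1 else 0)"
      by (rule sum.swap)
    also have "\<dots> = (\<Sum>w\<in>V. card {(u, v). (u, v) \<in> A \<and> (w, u) \<in> A \<and> (w, v) \<in> A})"
      using finA by (intro sum.cong refl) (simp flip: sum.inter_filter, intro arg_cong[of _ _ card], auto)
    also have "\<dots> \<le> (\<Sum>w\<in>V. K * card {v. (w, v) \<in> A})"
      by (intro sum_mono sparse)
    also have "\<dots> = K * card (SIGMA w:V. {v. (w, v) \<in> A})"
      using assms by (subst card_SigmaI) (auto simp: sum_distrib_left intro!: finite_subset[of _ V])
    also have "(SIGMA w:V. {v. (w, v) \<in> A}) = A" using assms by auto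
    finally show ?thesis .
  qed
  let ?c = "p * \<theta> / 16 * card A"
  have "(\<Sum>r\<in>R. \<Sum>(u, v)\<in>A. y r u * y r v) = (\<Sum>(u, v)\<in>A. \<Sum>r\<in>R. y r u * y r v)"
    by (subst sum.swap) (simp add: case_prod_unfold)
  also have "\<dots> \<le> (\<Sum>(u, v)\<in>A. card R * (p\<^sup>2 * card (B u \<inter> B v) * \<theta>\<^sup>2 - p * (1 - p) * \<theta> / 4))"
    using edge by (intro sum_mono) auto
  also have "\<dots> = card R * (p\<^sup>2 * \<theta>\<^sup>2 * real (\<Sum>(u, v)\<in>A. card (B u \<inter> B v)) - card A * (p * (1 - p) * \<theta> / 4))"
    by (simp add: case_prod_unfold sum_subtractf sum_distrib_left right_diff_distrib algebra_simps)
  also have "\<dots> \<le> card R * (p\<^sup>2 * \<theta>\<^sup>2 * real (K * card A) - card A * (p * (1 - p) * \<theta> / 4))"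
    using triangles by (intro mult_left_mono diff_mono of_nat_mono) auto
  also have "\<dots> = card R * (p * \<theta> * card A * (p * K * \<theta> - (1 - p) / 4))"
    by (simp add: power2_eq_square algebra_simps)
  also have "\<dots> \<le> card R * (p * \<theta> * card A * (- 1 / 16))"
  proof -
    \<comment> \<open>The error is at most 1/8 and the gain \<open>(1 - p) / 4\<close> at least
      3/16, which leaves 1/16.\<close>
    have "p * K * \<theta> \<le> 1 / 4 * (1 / 2)" using p \<theta> by (intro mult_mono) auto
    then have "p * K * \<theta> - (1 - p) / 4 \<le> - 1 / 16" using p(2) by argo
    then show ?thesis using p \<theta> by (intro mult_left_mono) auto
  qed
  finally have avg: "(\<Sum>r\<in>R. \<Sum>(u, v)\<in>A. y r u * y r v) \<le> (\<Sum>r\<in>R. - ?c)"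
    by (simp add: mult.commute mult.left_commute)
  have "R \<noteq> {}" using cardR by (metis card.empty power_not_zero zero_neq_numeral)
  then obtain r where "r \<in> R" and r: "(\<Sum>(u, v)\<in>A. y r u * y r v) \<le> - ?c"
    using avg sum_strict_mono[OF finR, of "\<lambda>_. - ?c" "\<lambda>r. \<Sum>(u, v)\<in>A. y r u * y r v"]
    by (meson linorder_not_le)
  \<comment> \<open>The weights \<open>1 - p\<close> and \<open>p\<close> add up to 1, which makes
    \<open>y r\<close> admissible for rounding.\<close>
  have "\<bar>y r v\<bar> \<le> 1" for v
  proof -
    have "\<bar>(1 - p) * sin s\<bar> \<le> 1 - p" "\<bar>p * sin s\<bar> \<le> p" for s
      using p by (auto simp: abs_mult mult_left_le)
    from this(1)[of "l (e v) r"] this(2)[of "l (a v) r"] show ?thesis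
      unfolding y_def abs_le_iff by linarith
  qed
  then obtain s where s: "\<forall>v\<in>V. s v \<in> {-1, 1}" "(\<Sum>(u, v)\<in>A. s u * s v) \<le> (\<Sum>(u, v)\<in>A. y r u * y r v)"
    using round_to_signs[OF finA _ \<open>finite V\<close>, of "y r"] asym by metis
  have "?c = real (card A) / (128 * (real K + 1) * sqrt D)"
    by (simp add: p_def \<theta>_def field_simps)
  then show ?thesis using s r by (intro exI[of _ s]) auto
qed

section \<open>Degenerate graphs and embeddings of forests\<close>

text \<open>Taking an edge set and a vertex set separately allows the same edges to be restricted to
  a neighbourhood.\<close>

definition degenerate :: "'a set set \<Rightarrow> nat \<Rightarrow> 'a set \<Rightarrow> bool" where
  "degenerate E D V \<longleftrightarrow> (\<forall>S\<subseteq>V. S \<noteq> {} \<longrightarrow> (\<exists>x\<in>S. card {y\<in>S. {x, y} \<in> E} \<le> D))"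

definition oriented_edges :: "'a set set \<Rightarrow> ('a \<Rightarrow> nat) \<Rightarrow> 'a set \<Rightarrow> ('a \<times> 'a) set" where
  "oriented_edges E f V = {(u, v). u \<in> V \<and> v \<in> V \<and> {u, v} \<in> E \<and> f u < f v}"

text \<open>Put a vertex with at most \<open>D\<close> neighbours last and order the others by
  induction; the last vertex is never counted as an earlier neighbour of another one.\<close>

lemma degenerate_order:
  assumes "finite V" "degenerate E D V"
  shows "\<exists>f :: 'a \<Rightarrow> nat. inj_on f V \<and> (\<forall>x\<in>V. card {y\<in>V. {x, y} \<in> E \<and> f y < f x} \<le> D)"
  using assms
proof (induction V rule: finite_psubset_induct)
  case (psubset V)
  show ?case
  proof (cases "V = {}")
    case False
    then obtain x where x: "x \<in> V" "card {y\<in>V. {x, y} \<in> E} \<le> D"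
      using psubset.prems unfolding degenerate_def by blast
    have "degenerate E D (V - {x})"
      using psubset.prems unfolding degenerate_def by blast
    then obtain f :: "'a \<Rightarrow> nat" where f: "inj_on f (V - {x})"
      "\<And>z. z \<in> V - {x} \<Longrightarrow> card {y\<in>V - {x}. {z, y} \<in> E \<and> f y < f z} \<le> D"
      using psubset.IH[of "V - {x}"] x by blast
    obtain b where b: "\<And>y. y \<in> V - {x} \<Longrightarrow> f y < b"
      using finite_nat_set_iff_bounded[of "f ` (V - {x})"] psubset.hyps by auto
    let ?g = "f(x := b)"
    have "inj_on ?g V"
      using f(1) b by (fastforce simp: inj_on_def)
    moreover have "card {y\<in>V. {z, y} \<in> E \<and> ?g y < ?g z} \<le> D" if "z \<in> V" for z
    proof (cases "z = x")
      case True
      then have "card {y\<in>V. {z, y} \<in> E \<and> ?g y < ?g z} \<le> card {y\<in>V. {x, y} \<in> E}"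
        using psubset.hyps by (intro card_mono) auto
      with x show ?thesis by simp
    next
      case False
      then have "{y\<in>V. {z, y} \<in> E \<and> ?g y < ?g z} = {y\<in>V - {x}. {z, y} \<in> E \<and> f y < f z}"
        using that b[of z] by (auto split: if_splits)
      then show ?thesis using f(2)[of z] that False by simp
    qed
    ultimately show ?thesis by blast
  qed auto
qed

lemma bij_betw_oriented_edges:
  assumes "inj_on f V" "\<forall>e\<in>E. card e = 2"
  shows "bij_betw (\<lambda>(u, v). {u, v}) (oriented_edges E f V) {e\<in>E. e \<subseteq> V}"
  unfolding bij_betw_def
proof
  show "inj_on (\<lambda>(u, v). {u, v}) (oriented_edges E f V)"
    by (auto simp: inj_on_def oriented_edges_def doubleton_eq_iff)
  have "e \<in> (\<lambda>(u, v). {u, v}) ` oriented_edges E f V" if e: "e \<in> E" "e \<subseteq> V" for e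
  proof -
    obtain u v where uv: "e = {u, v}" "u \<noteq> v" using assms e by (metis card_2_iff)
    then have "f u < f v \<or> f v < f u" using assms(1) e by (metis inj_onD insert_subset linorder_neqE_nat)
    then have "(u, v) \<in> oriented_edges E f V \<or> (v, u) \<in> oriented_edges E f V"
      using e uv by (auto simp: oriented_edges_def insert_commute)
    then show ?thesis using uv by (force simp: insert_commute)
  qed
  then show "(\<lambda>(u, v). {u, v}) ` oriented_edges E f V = {e\<in>E. e \<subseteq> V}"
    by (auto simp: oriented_edges_def)
qed

text \<open>The number of oriented edges does not depend on the ordering, so \<open>g\<close> may be
  replaced by a degeneracy order, where each vertex has at most \<open>D\<close> earlier
  neighbours.\<close>

lemma card_oriented_edges_le:
  assumes "finite V" "degenerate E D V" "inj_on g V" "\<forall>e\<in>E. card e = 2"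
  shows "card (oriented_edges E g V) \<le> D * card V"
proof -
  obtain f :: "'a \<Rightarrow> nat" where f: "inj_on f V" "\<And>x. x \<in> V \<Longrightarrow> card {y\<in>V. {x, y} \<in> E \<and> f y < f x} \<le> D"
    using degenerate_order[OF assms(1,2)] by blast
  have "card (oriented_edges E g V) = card (oriented_edges E f V)"
    using bij_betw_same_card[OF bij_betw_oriented_edges[OF assms(3,4)]]
      bij_betw_same_card[OF bij_betw_oriented_edges[OF f(1) assms(4)]] by simp
  also have "\<dots> = card (SIGMA x:V. {y\<in>V. {x, y} \<in> E \<and> f y < f x})"
    by (rule bij_betw_same_card[of prod.swap])
      (auto simp: bij_betw_def inj_on_def oriented_edges_def insert_commute image_iff)
  also have "\<dots> = (\<Sum>x\<in>V. card {y\<in>V. {x, y} \<in> E \<and> f y < f x})"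
    using assms by (subst card_SigmaI) auto
  also have "\<dots> \<le> D * card V"
    using sum_bounded_above[of V _ D] f(2) by (simp add: mult.commute)
  finally show ?thesis .
qed

section \<open>Cuts from sign vectors\<close>

lemma finite_edges: "fin_simple_graph G \<Longrightarrow> finite (edges G)"
  by (auto simp: fin_simple_graph_def intro: finite_subset[of _ "Pow (verts G)"])

lemma mc_ge:
  assumes "fin_simple_graph G" "subgraph B G" "bipartite B"
  shows "card (edges B) \<le> mc G"
proof -
  have "{card (edges B) | B. subgraph B G \<and> bipartite B} \<subseteq> {..card (edges G)}"
    using finite_edges[OF assms(1)] by (auto simp: subgraph_def intro: card_mono)
  then show ?thesis unfolding mc_def
    using assms by (intro Max_ge) (auto intro: finite_subset)
qed

text \<open>An edge contributes -1 to the sum if the signs cut it and 1 otherwise, so the sum is the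
  number of edges minus twice the size of the cut.\<close>

lemma surplus_ge_of_signs:
  assumes G: "fin_simple_graph G" and f: "inj_on f (verts G)"
    and s: "\<forall>v\<in>verts G. s v \<in> {-1, 1 :: real}"
  shows "- (\<Sum>(u, v)\<in>oriented_edges (edges G) f (verts G). s u * s v) / 2 \<le> surplus G"
proof -
  let ?A = "oriented_edges (edges G) f (verts G)"
  let ?X = "{(u, v)\<in>?A. s u \<noteq> s v}"
  define B where "B = \<lparr>verts = verts G, edges = (\<lambda>(u, v). {u, v}) ` ?X\<rparr>"
  have bij: "bij_betw (\<lambda>(u, v). {u, v}) ?A (edges G)"
  proof -
    have "{e\<in>edges G. e \<subseteq> verts G} = edges G" using G by (auto simp: fin_simple_graph_def)
    then show ?thesis using bij_betw_oriented_edges[OF f, of "edges G"] G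
      by (simp add: fin_simple_graph_def)
  qed
  have fin: "finite ?A"
    by (rule finite_subset[of _ "verts G \<times> verts G"]) (use G in \<open>auto simp: oriented_edges_def fin_simple_graph_def\<close>)
  have sub: "(\<lambda>(u, v). {u, v}) ` ?X \<subseteq> edges G"
    by (auto simp: oriented_edges_def)
  then have "subgraph B G" using G by (fastforce simp: subgraph_def B_def fin_simple_graph_def oriented_edges_def)
  moreover have "bipartite B"
    unfolding bipartite_def
  proof (intro exI conjI ballI)
    show "{v\<in>verts G. s v = 1} \<union> {v\<in>verts G. s v = -1} = verts B"
      using s by (auto simp: B_def)
    show "{v\<in>verts G. s v = 1} \<inter> {v\<in>verts G. s v = -1} = {}" by auto
    fix e assume "e \<in> edges B"
    then obtain u v where uv: "e = {u, v}" "u \<in> verts G" "v \<in> verts G" "s u \<noteq> s v"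
      by (auto simp: B_def oriented_edges_def)
    moreover have "s u \<in> {-1, 1}" "s v \<in> {-1, 1}" using s uv by blast+
    ultimately have "s u = 1 \<and> s v = -1 \<or> s v = 1 \<and> s u = -1" by auto
    then show "\<exists>a\<in>{v\<in>verts G. s v = 1}. \<exists>b\<in>{v\<in>verts G. s v = -1}. e = {a, b}"
      using uv by (auto simp: insert_commute)
  qed
  ultimately have "card (edges B) \<le> mc G" using G by (intro mc_ge)
  moreover have "card (edges B) = card ?X"
    unfolding B_def graph.simps
    by (rule card_image[OF inj_on_subset[OF bij_betw_imp_inj_on[OF bij]]]) auto
  moreover have "(\<Sum>(u, v)\<in>?A. s u * s v) = (\<Sum>(u, v)\<in>?A. 1 - 2 * (if s u \<noteq> s v then 1 else 0))"
  proof (intro sum.cong refl, clarify)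
    fix u v assume "(u, v) \<in> ?A"
    then have "s u \<in> {-1, 1}" "s v \<in> {-1, 1}" using s by (auto simp: oriented_edges_def)
    then show "s u * s v = 1 - 2 * (if s u \<noteq> s v then 1 else 0)" by auto
  qed
  then have "(\<Sum>(u, v)\<in>?A. s u * s v) = real (card ?A) - 2 * (\<Sum>(u, v)\<in>?A. if s u \<noteq> s v then 1 else 0)"
    by (simp add: case_prod_unfold sum_subtractf sum_distrib_left)
  moreover have "(\<Sum>(u, v)\<in>?A. if s u \<noteq> s v then 1 else 0) = real (card ?X)"
    using fin by (simp add: case_prod_unfold flip: sum.inter_filter)
  moreover have "card ?A = card (edges G)" using bij by (rule bij_betw_same_card)
  ultimately show ?thesis unfolding surplus_def by simp
qed

text \<open>Along a degeneracy order \<open>D\<close> bounds the in-degrees, while \<open>K\<close>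
  bounds the edge density inside out-neighbourhoods. The constant 128 doubles because the surplus is
  half the negated sum.\<close>

lemma surplus_ge_of_degenerate:
  assumes G: "fin_simple_graph G" and D: "degenerate (edges G) D (verts G)" "D \<ge> 1"
    and K: "\<And>w. w \<in> verts G \<Longrightarrow> degenerate (edges G) K {v. {w, v} \<in> edges G}"
  shows "real (card (edges G)) / (256 * (real K + 1) * sqrt D) \<le> surplus G"
proof -
  let ?V = "verts G"
  have fin: "finite ?V" and E: "\<forall>e\<in>edges G. card e = 2" and sub: "\<And>e. e \<in> edges G \<Longrightarrow> e \<subseteq> ?V"
    using G by (auto simp: fin_simple_graph_def)
  obtain f :: "'a \<Rightarrow> nat" where f: "inj_on f ?V"
    "\<And>x. x \<in> ?V \<Longrightarrow> card {y\<in>?V. {x, y} \<in> edges G \<and> f y < f x} \<le> D"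
    using degenerate_order[OF fin D(1)] by blast
  define A where "A = oriented_edges (edges G) f ?V"
  have "\<exists>s. (\<forall>v\<in>?V. s v \<in> {-1, 1}) \<and>
    (\<Sum>(u, v)\<in>A. s u * s v) \<le> - (real (card A) / (128 * (real K + 1) * sqrt D))"
  proof (rule exists_negatively_correlated_signs[OF fin])
    show "card {u. (u, v) \<in> A} \<le> D" if "v \<in> ?V" for v
    proof -
      have "{u. (u, v) \<in> A} = {y\<in>?V. {v, y} \<in> edges G \<and> f y < f v}"
        using that by (auto simp: A_def oriented_edges_def insert_commute)
      then show ?thesis using f(2)[OF that] by simp
    qed
    fix w assume w: "w \<in> ?V"
    let ?N = "{v. (w, v) \<in> A}"
    have N: "?N \<subseteq> ?V" "?N \<subseteq> {v. {w, v} \<in> edges G}" by (auto simp: A_def oriented_edges_def)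
    have "{(u, v). (u, v) \<in> A \<and> (w, u) \<in> A \<and> (w, v) \<in> A} = oriented_edges (edges G) f ?N"
      by (auto simp: A_def oriented_edges_def)
    moreover have "degenerate (edges G) K ?N"
      using K[OF w] subset_trans[OF _ N(2)] unfolding degenerate_def by simp
    moreover have "inj_on f ?N" "finite ?N" using inj_on_subset[OF f(1)] finite_subset[OF _ fin] N by auto
    ultimately show "card {(u, v). (u, v) \<in> A \<and> (w, u) \<in> A \<and> (w, v) \<in> A} \<le> K * card ?N"
      using E by (simp add: card_oriented_edges_le)
  qed (use D in \<open>auto simp: A_def oriented_edges_def\<close>)
  then obtain s where s: "\<forall>v\<in>?V. s v \<in> {-1, 1}"
    "(\<Sum>(u, v)\<in>A. s u * s v) \<le> - (real (card A) / (128 * (real K + 1) * sqrt D))" by blast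
  have "{e\<in>edges G. e \<subseteq> ?V} = edges G" using sub by auto
  then have "card A = card (edges G)"
    using bij_betw_same_card[OF bij_betw_oriented_edges[OF f(1) E]] by (simp add: A_def)
  then have "real (card (edges G)) / (256 * (real K + 1) * sqrt D) = real (card A) / (128 * (real K + 1) * sqrt D) / 2"
    by simp
  also have "\<dots> \<le> - (\<Sum>(u, v)\<in>A. s u * s v) / 2"
    using le_imp_neg_le[OF s(2)] by (intro divide_right_mono) simp_all
  also have "\<dots> \<le> surplus G" using surplus_ge_of_signs[OF G f(1) s(1)] by (simp add: A_def)
  finally show ?thesis .
qed

section \<open>Forests in graphs of large minimum degree\<close>

text \<open>All neighbours of the first vertex of a longest path lie on the path, and a neighbour
  other than the second vertex would close a cycle. Isolated vertices count as leaves.\<close>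

lemma acyclic_has_leaf:
  assumes F: "fin_simple_graph F" "acyclic_graph F" "verts F \<noteq> {}"
  shows "\<exists>x\<in>verts F. \<forall>y z. {x, y} \<in> edges F \<longrightarrow> {x, z} \<in> edges F \<longrightarrow> y = z"
proof (rule ccontr)
  assume "\<not> ?thesis"
  then have two: "\<And>x. x \<in> verts F \<Longrightarrow> \<exists>y z. {x, y} \<in> edges F \<and> {x, z} \<in> edges F \<and> y \<noteq> z" by blast
  define P where "P xs \<longleftrightarrow> xs \<noteq> [] \<and> distinct xs \<and> set xs \<subseteq> verts F \<and>
    (\<forall>i. Suc i < length xs \<longrightarrow> {xs ! i, xs ! Suc i} \<in> edges F)" for xs
  have loopless: "{x, x} \<notin> edges F" for x using F by (auto simp: fin_simple_graph_def)
  obtain x0 where "x0 \<in> verts F" using F by blast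
  then have "P [x0]" by (simp add: P_def)
  moreover have "length xs < Suc (card (verts F))" if "P xs" for xs
    using that F card_mono[of "verts F" "set xs"] distinct_card[of xs]
    by (auto simp: P_def fin_simple_graph_def)
  ultimately obtain xs where xs: "P xs" and max: "\<And>ys. P ys \<Longrightarrow> length ys \<le> length xs"
    using ex_has_greatest_nat[of P "[x0]" length "Suc (card (verts F))"] by (metis less_imp_le_nat)
  have nbr: "y \<in> set xs" if "{xs ! 0, y} \<in> edges F" for y
  proof (rule ccontr)
    assume "y \<notin> set xs"
    moreover have "y \<in> verts F" using that F by (auto simp: fin_simple_graph_def)
    ultimately have "P (y # xs)"
      using xs that by (auto simp: P_def nth_Cons insert_commute split: nat.split)
    then show False using max[of "y # xs"] by simp
  qed
  have "xs ! 0 \<in> verts F" using xs by (force simp: P_def)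
  \<comment> \<open>The guard is there because \<open>xs ! 1\<close> is unspecified when the path is
    a single vertex.\<close>
  then obtain y where y: "{xs ! 0, y} \<in> edges F" "length xs > 1 \<longrightarrow> y \<noteq> xs ! 1"
    using two by metis
  then obtain j where j: "j < length xs" "y = xs ! j"
    using nbr by (metis in_set_conv_nth)
  have "j \<noteq> 0" "j \<noteq> 1" using y j loopless by (metis, auto)
  then have "2 \<le> j" by simp
  \<comment> \<open>The initial segment ending at \<open>y\<close> is closed by the edge back to
    \<open>xs ! 0\<close>; \<open>2 \<le> j\<close> gives it at least three vertices.\<close>
  have "is_cycle F (take (Suc j) xs)"
    unfolding is_cycle_def
  proof (intro conjI allI impI)
    show "set (take (Suc j) xs) \<subseteq> verts F" "distinct (take (Suc j) xs)"
      using xs set_take_subset[of "Suc j" xs] unfolding P_def by auto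
    show "3 \<le> length (take (Suc j) xs)" using j \<open>2 \<le> j\<close> by simp
    fix i assume "i < length (take (Suc j) xs)"
    then consider "i < j" | "i = j" using j by fastforce
    then show "{take (Suc j) xs ! i, take (Suc j) xs ! (Suc i mod length (take (Suc j) xs))} \<in> edges F"
    proof cases
      case 1
      then show ?thesis using xs j by (simp add: P_def)
    next
      case 2
      then show ?thesis using y j by (simp add: insert_commute)
    qed
  qed
  then show False using F by (auto simp: acyclic_graph_def)
qed

lemma delete_vertex_simple: "fin_simple_graph F \<Longrightarrow> fin_simple_graph (delete_vertex F x)"
  by (auto simp: fin_simple_graph_def delete_vertex_def)

lemma delete_vertex_acyclic: "acyclic_graph F \<Longrightarrow> acyclic_graph (delete_vertex F x)"
  by (fastforce simp: acyclic_graph_def is_cycle_def delete_vertex_def)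

lemma forest_embeds:
  assumes "fin_simple_graph F" "acyclic_graph F" "card (verts F) \<le> k"
    and "finite S" "S \<noteq> {}" and deg: "\<And>x. x \<in> S \<Longrightarrow> k \<le> card {y\<in>S. {x, y} \<in> E}"
  shows "\<exists>f. inj_on f (verts F) \<and> f ` verts F \<subseteq> S \<and> (\<forall>e\<in>edges F. f ` e \<in> E)"
  using assms(1-3)
proof (induction "card (verts F)" arbitrary: F)
  case 0
  then have "verts F = {}" by (simp add: fin_simple_graph_def)
  moreover from this have "edges F = {}" using 0 by (fastforce simp: fin_simple_graph_def)
  ultimately show ?case by simp
next
  case (Suc n)
  have finF: "finite (verts F)" using Suc by (simp add: fin_simple_graph_def)
  obtain x where x: "x \<in> verts F" "\<And>y z. {x, y} \<in> edges F \<Longrightarrow> {x, z} \<in> edges F \<Longrightarrow> y = z"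
    using acyclic_has_leaf[of F] Suc by (metis card.empty nat.distinct(1))
  let ?F = "delete_vertex F x"
  have V: "verts ?F = verts F - {x}" by (simp add: delete_vertex_def)
  then have cV: "card (verts ?F) = n" using Suc.hyps(2) x finF by simp
  then obtain f where f: "inj_on f (verts F - {x})" "f ` (verts F - {x}) \<subseteq> S"
    "\<And>e. e \<in> edges F \<Longrightarrow> x \<notin> e \<Longrightarrow> f ` e \<in> E"
    using Suc.hyps(1)[of ?F] Suc.prems Suc.hyps(2) delete_vertex_simple delete_vertex_acyclic V
    by (force simp: delete_vertex_def)
  \<comment> \<open>Only \<open>n\<close> vertices of \<open>S\<close> are occupied, whereas
    \<open>t\<close> has at least \<open>k \<ge> Suc n\<close> neighbours in
    \<open>S\<close>.\<close>
  have new: "\<exists>z. z \<in> S \<and> {t, z} \<in> E \<and> z \<notin> f ` (verts F - {x})" if "t \<in> S" for t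
  proof (rule ccontr)
    assume "\<not> ?thesis"
    then have "{y\<in>S. {t, y} \<in> E} \<subseteq> f ` (verts F - {x})" by blast
    then have "card {y\<in>S. {t, y} \<in> E} \<le> card (f ` (verts F - {x}))" using finF by (intro card_mono) auto
    also have "\<dots> \<le> n" using cV V card_image_le[of "verts F - {x}" f] finF by simp
    finally show False using deg[OF that] Suc by simp
  qed
  have "\<exists>z. z \<in> S \<and> z \<notin> f ` (verts F - {x}) \<and> (\<forall>y. {x, y} \<in> edges F \<longrightarrow> {f y, z} \<in> E)"
  proof (cases "\<exists>y. {x, y} \<in> edges F")
    case True
    then obtain y where y: "{x, y} \<in> edges F" by blast
    then have "y \<in> verts F - {x}" using Suc.prems(1) by (auto simp: fin_simple_graph_def)
    then have "f y \<in> S" using f(2) by blast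
    then show ?thesis using new[of "f y"] x(2)[OF y] by blast
  next
    case False
    then show ?thesis using new \<open>S \<noteq> {}\<close> by blast
  qed
  then obtain z where z: "z \<in> S" "z \<notin> f ` (verts F - {x})" "\<And>y. {x, y} \<in> edges F \<Longrightarrow> {f y, z} \<in> E" by blast
  let ?f = "f(x := z)"
  have "inj_on ?f (verts F)"
    using f(1) z(2) by (auto simp: inj_on_def)
  moreover have "?f ` verts F \<subseteq> S" using f(2) z(1) by auto
  moreover have "?f ` e \<in> E" if e: "e \<in> edges F" for e
  proof (cases "x \<in> e")
    case True
    moreover have "card e = 2" using e Suc.prems by (auto simp: fin_simple_graph_def)
    ultimately obtain y where y: "e = {x, y}" "x \<noteq> y" by (auto simp: card_2_iff)
    then show ?thesis using z(3)[of y] e by (simp add: insert_commute)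
  next
    case False
    then have "?f ` e = f ` e" by (intro image_cong) auto
    then show ?thesis using f(3) e False by simp
  qed
  ultimately show ?case by blast
qed

text \<open>The copy of \<open>H\<close> carries the image edges only: \<open>graph_iso\<close> is
  an equivalence on edges, and \<open>G\<close> may have further edges between image
  vertices.\<close>

lemma embedding_not_free:
  assumes H: "fin_simple_graph H" and f: "inj_on f (verts H)" "f ` verts H \<subseteq> verts G"
    "\<And>e. e \<in> edges H \<Longrightarrow> f ` e \<in> edges G"
  shows "\<not> graph_free H G"
proof -
  let ?G = "\<lparr>verts = f ` verts H, edges = (`) f ` edges H\<rparr>"
  have sub: "e \<subseteq> verts H" "card e = 2" if "e \<in> edges H" for e
    using H that by (auto simp: fin_simple_graph_def)
  have "subgraph ?G G"
    unfolding subgraph_def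
  proof (intro conjI)
    show "fin_simple_graph ?G"
      unfolding fin_simple_graph_def
    proof (intro conjI ballI)
      fix e' assume "e' \<in> edges ?G"
      then obtain e where e: "e \<in> edges H" "e' = f ` e" by auto
      then show "e' \<subseteq> verts ?G" "card e' = 2"
        using sub[of e] card_image[OF inj_on_subset[OF f(1)], of e] by auto
    qed (use H in \<open>simp add: fin_simple_graph_def\<close>)
  qed (use f in auto)
  moreover have "graph_iso H ?G"
    unfolding graph_iso_def
  proof (intro exI[of _ f] conjI ballI)
    show "bij_betw f (verts H) (verts ?G)" using f by (simp add: bij_betw_def)
    fix u v assume uv: "u \<in> verts H" "v \<in> verts H"
    have "{u, v} \<in> edges H" if "f ` e = f ` {u, v}" "e \<in> edges H" for e
      using inj_on_image_eq_iff[OF f(1), of e "{u, v}"] that uv sub(1)[of e] by auto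
    then have "{u, v} \<in> edges H" if "f ` {u, v} \<in> (`) f ` edges H"
      using that by (elim imageE) simp
    moreover have "f ` {u, v} \<in> (`) f ` edges H" if "{u, v} \<in> edges H"
      using that by (rule imageI)
    ultimately show "{u, v} \<in> edges H \<longleftrightarrow> {f u, f v} \<in> edges ?G" by auto
  qed
  ultimately show ?thesis unfolding graph_free_def by blast
qed

text \<open>A violating set \<open>S\<close> has minimum degree large enough to contain the forest
  \<open>delete_vertex H v\<close>. Since \<open>w\<close> is adjacent to all of \<open>S\<close>,
  mapping \<open>v\<close> to \<open>w\<close> completes a copy of \<open>H\<close>.\<close>

lemma neighbourhood_degenerate:
  assumes H: "fin_simple_graph H" "v \<in> verts H" "acyclic_graph (delete_vertex H v)"
    and G: "fin_simple_graph G" "graph_free H G"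
  shows "degenerate (edges G) (card (verts H)) {x. {w, x} \<in> edges G}"
  unfolding degenerate_def
proof (intro allI impI, rule ccontr)
  fix S assume S: "S \<subseteq> {x. {w, x} \<in> edges G}" "S \<noteq> {}"
    and "\<not> (\<exists>x\<in>S. card {y\<in>S. {x, y} \<in> edges G} \<le> card (verts H))"
  then have deg: "card (verts H) \<le> card {y\<in>S. {x, y} \<in> edges G}" if "x \<in> S" for x
    using that by (meson nat_le_linear)
  have SV: "S \<subseteq> verts G - {w}" and w: "w \<in> verts G"
    using S G(1) by (fastforce simp: fin_simple_graph_def)+
  have finS: "finite S" using SV G(1) finite_subset by (auto simp: fin_simple_graph_def)
  have "card (verts (delete_vertex H v)) \<le> card (verts H)"
    using H by (auto simp: delete_vertex_def fin_simple_graph_def intro: card_mono)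
  then obtain f where f: "inj_on f (verts H - {v})" "f ` (verts H - {v}) \<subseteq> S"
    "\<And>e. e \<in> edges H \<Longrightarrow> v \<notin> e \<Longrightarrow> f ` e \<in> edges G"
    using forest_embeds[OF delete_vertex_simple[OF H(1)] H(3) _ finS S(2) deg]
    by (auto simp: delete_vertex_def)
  let ?f = "f(v := w)"
  have "?f ` e \<in> edges G" if e: "e \<in> edges H" for e
  proof (cases "v \<in> e")
    case True
    moreover have "card e = 2" "e \<subseteq> verts H" using e H by (auto simp: fin_simple_graph_def)
    ultimately obtain y where y: "e = {v, y}" "v \<noteq> y" "y \<in> verts H" by (auto simp: card_2_iff)
    then have "{w, f y} \<in> edges G" using f(2) S by blast
    then show ?thesis using y by (simp add: insert_commute)
  next
    case False
    then have "?f ` e = f ` e" by (intro image_cong) auto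
    then show ?thesis using f(3) e False by simp
  qed
  moreover have "inj_on ?f (verts H)" using f(1,2) SV by (fastforce simp: inj_on_def)
  moreover have "?f ` verts H \<subseteq> verts G" using f(2) SV w by auto
  ultimately show False using embedding_not_free[OF H(1)] G(2) by blast
qed

section \<open>Consequences of the Turan bound\<close>

text \<open>A supremum of naturals bounds its members only if the set is bounded; edges are subsets
  of the vertex set, so a power of 2 serves.\<close>

lemma card_edges_le_turan_ex:
  fixes G :: "nat graph"
  assumes "fin_simple_graph G" "graph_free H G"
  shows "card (edges G) \<le> turan_ex (card (verts G)) H"
  unfolding turan_ex_def
proof (rule cSup_upper)
  show "bdd_above {card (edges G') | G' :: nat graph.
    fin_simple_graph G' \<and> graph_free H G' \<and> card (verts G') = card (verts G)}"
  proof (rule bdd_aboveI)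
    fix c assume "c \<in> {card (edges G') | G' :: nat graph.
      fin_simple_graph G' \<and> graph_free H G' \<and> card (verts G') = card (verts G)}"
    then obtain G' :: "nat graph" where G': "fin_simple_graph G'" "card (verts G') = card (verts G)"
      "c = card (edges G')" by blast
    then have "c \<le> card (Pow (verts G'))"
      by (auto simp: fin_simple_graph_def intro!: card_mono)
    then show "c \<le> 2 ^ card (verts G)" using G' by (simp add: card_Pow fin_simple_graph_def)
  qed
qed (use assms in blast)

lemma graph_free_subgraph: "graph_free H G \<Longrightarrow> subgraph G' G \<Longrightarrow> graph_free H G'"
  unfolding graph_free_def subgraph_def by (meson order_trans)

lemma handshake:
  assumes "fin_simple_graph G"
  shows "(\<Sum>x\<in>verts G. card {y\<in>verts G. {x, y} \<in> edges G}) = 2 * card (edges G)"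
proof -
  have fin: "finite (verts G)" and E: "\<forall>e\<in>edges G. e \<subseteq> verts G \<and> card e = 2"
    using assms by (auto simp: fin_simple_graph_def)
  have "(\<Sum>x\<in>verts G. card {y\<in>verts G. {x, y} \<in> edges G})
      = (\<Sum>x\<in>verts G. card {e\<in>edges G. x \<in> e})"
  proof (intro sum.cong refl bij_betw_same_card)
    fix x assume "x \<in> verts G"
    show "bij_betw (\<lambda>y. {x, y}) {y\<in>verts G. {x, y} \<in> edges G} {e\<in>edges G. x \<in> e}"
      unfolding bij_betw_def
    proof
      show "inj_on (\<lambda>y. {x, y}) {y\<in>verts G. {x, y} \<in> edges G}"
        by (auto simp: inj_on_def doubleton_eq_iff)
      have "e \<in> (\<lambda>y. {x, y}) ` {y\<in>verts G. {x, y} \<in> edges G}" if e: "e \<in> edges G" "x \<in> e" for e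
      proof -
        have "card e = 2" "e \<subseteq> verts G" using E e by auto
        then obtain y where "e = {x, y}" using e by (auto simp: card_2_iff)
        then show ?thesis using e \<open>e \<subseteq> verts G\<close> by auto
      qed
      then show "(\<lambda>y. {x, y}) ` {y\<in>verts G. {x, y} \<in> edges G} = {e\<in>edges G. x \<in> e}" by auto
    qed
  qed
  also have "\<dots> = (\<Sum>e\<in>edges G. card {x\<in>verts G. x \<in> e})"
    using sum_multicount_gen[OF fin finite_edges[OF assms], of "\<lambda>x e. x \<in> e" "\<lambda>e. card {x\<in>verts G. x \<in> e}"]
    by simp
  also have "\<dots> = (\<Sum>e\<in>edges G. 2)"
  proof (intro sum.cong refl)
    fix e assume "e \<in> edges G"
    then have "{x\<in>verts G. x \<in> e} = e" "card e = 2" using E by auto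
    then show "card {x\<in>verts G. x \<in> e} = 2" by simp
  qed
  finally show ?thesis by simp
qed

text \<open>The subgraph induced on \<open>S\<close> has at least
  \<open>card S * \<delta> / 2\<close> edges, so \<open>card S\<close> is at most
  \<open>2 * card (edges G) / \<delta>\<close>. The Turan bound for this subgraph gives
  \<open>\<delta> \<le> 2 * C * real (card S) powr \<alpha>\<close>, and the two combine.\<close>

lemma min_degree_bound:
  fixes G :: "nat graph" and \<alpha> C \<delta> :: real
  assumes G: "fin_simple_graph G" "graph_free H G"
    and turan: "\<forall>n::nat. n \<ge> 1 \<longrightarrow> real (turan_ex n H) \<le> C * real n powr (1 + \<alpha>)"
    and "\<alpha> \<ge> 0" "C > 0" and S: "S \<subseteq> verts G" "S \<noteq> {}" and "\<delta> > 0"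
    and deg: "\<And>x. x \<in> S \<Longrightarrow> \<delta> \<le> real (card {y\<in>S. {x, y} \<in> edges G})"
  shows "\<delta> powr (1 + \<alpha>) \<le> C * 2 powr (1 + \<alpha>) * real (card (edges G)) powr \<alpha>"
proof -
  define G' where "G' = \<lparr>verts = S, edges = {e\<in>edges G. e \<subseteq> S}\<rparr>"
  have simp': "fin_simple_graph G'" and sub: "subgraph G' G"
    using G S finite_subset by (auto simp: fin_simple_graph_def subgraph_def G'_def)
  have finS: "finite S" using simp' by (simp add: fin_simple_graph_def G'_def)
  have n: "card S \<ge> 1" using S finS by (simp add: Suc_le_eq card_gt_0_iff)
  have "card S * \<delta> \<le> (\<Sum>x\<in>S. real (card {y\<in>S. {x, y} \<in> edges G}))"
    using deg by (intro sum_bounded_below) auto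
  also have "\<dots> = real (\<Sum>x\<in>verts G'. card {y\<in>verts G'. {x, y} \<in> edges G'})"
    by (auto simp: G'_def intro!: sum.cong arg_cong[of _ _ card])
  also have "\<dots> = 2 * card (edges G')" by (simp add: handshake[OF simp'])
  finally have e: "card S * \<delta> \<le> 2 * card (edges G')" .
  have "card (edges G') \<le> card (edges G)"
    using finite_edges[OF G(1)] by (auto simp: G'_def intro: card_mono)
  then have "card S * \<delta> \<le> 2 * card (edges G)" using e by simp
  then have n_le: "real (card S) \<le> 2 * card (edges G) / \<delta>" using \<open>\<delta> > 0\<close> by (simp add: field_simps)
  have "real (card (edges G')) \<le> C * real (card S) powr (1 + \<alpha>)"
    using card_edges_le_turan_ex[OF simp' graph_free_subgraph[OF G(2) sub]] turan n
    by (simp add: G'_def) (meson of_nat_le_iff order_trans)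
  then have "card S * \<delta> \<le> 2 * (C * real (card S) powr (1 + \<alpha>))"
    using e by linarith
  also have "\<dots> = card S * (2 * C * real (card S) powr \<alpha>)" using n by (simp add: powr_add)
  finally have "card S * \<delta> \<le> card S * (2 * C * real (card S) powr \<alpha>)" .
  then have "\<delta> \<le> 2 * C * real (card S) powr \<alpha>" using n by simp
  also have "\<dots> \<le> 2 * C * (2 * card (edges G) / \<delta>) powr \<alpha>"
    using n_le \<open>\<alpha> \<ge> 0\<close> \<open>C > 0\<close> by (intro mult_left_mono powr_mono2) auto
  finally have "\<delta> * \<delta> powr \<alpha> \<le> 2 * C * (2 * card (edges G) / \<delta>) powr \<alpha> * \<delta> powr \<alpha>"
    by (intro mult_right_mono) auto
  then show ?thesis using \<open>\<delta> > 0\<close>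
    by (simp add: powr_add powr_divide powr_mult mult_ac)
qed

lemma free_graph_degenerate:
  fixes G :: "nat graph" and \<alpha> C :: real
  assumes G: "fin_simple_graph G" "graph_free H G"
    and turan: "\<forall>n::nat. n \<ge> 1 \<longrightarrow> real (turan_ex n H) \<le> C * real n powr (1 + \<alpha>)"
    and "\<alpha> \<ge> 0" "C > 0" and m: "card (edges G) \<ge> 1"
  shows "\<exists>D\<ge>1. degenerate (edges G) D (verts G) \<and>
    real D \<le> (2 * C powr (1 / (1 + \<alpha>)) + 1) * real (card (edges G)) powr (\<alpha> / (1 + \<alpha>))"
proof -
  define m where "m = real (card (edges G))"
  \<comment> \<open>The value of \<open>\<delta>\<close> at which \<open>min_degree_bound\<close>
    holds with equality.\<close>
  define t where "t = 2 * C powr (1 / (1 + \<alpha>)) * m powr (\<alpha> / (1 + \<alpha>))"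
  have m1: "m \<ge> 1" using m by (simp add: m_def)
  have t0: "t > 0" using \<open>C > 0\<close> m1 by (simp add: t_def)
  have t_powr: "t powr (1 + \<alpha>) = C * 2 powr (1 + \<alpha>) * m powr \<alpha>"
    using \<open>\<alpha> \<ge> 0\<close> \<open>C > 0\<close> m1 by (simp add: t_def powr_mult powr_powr)
  \<comment> \<open>Strictly above \<open>t\<close>, so that minimum degree \<open>D\<close>
    contradicts \<open>min_degree_bound\<close>. The excess of at most 1 is absorbed by the
    \<open>+ 1\<close> in the constant, since the power of \<open>m\<close> is at least 1.\<close>
  define D where "D = nat \<lfloor>t\<rfloor> + 1"
  have D: "t < real D" "real D \<le> t + 1" using t0 by (simp_all add: D_def) linarith+
  have "degenerate (edges G) D (verts G)"
    unfolding degenerate_def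
  proof (intro allI impI, rule ccontr)
    fix S assume S: "S \<subseteq> verts G" "S \<noteq> {}" "\<not> (\<exists>x\<in>S. card {y\<in>S. {x, y} \<in> edges G} \<le> D)"
    then have "\<And>x. x \<in> S \<Longrightarrow> real D \<le> real (card {y\<in>S. {x, y} \<in> edges G})"
      by (meson nat_le_linear of_nat_le_iff)
    then have "real D powr (1 + \<alpha>) \<le> t powr (1 + \<alpha>)"
      using min_degree_bound[OF G turan \<open>\<alpha> \<ge> 0\<close> \<open>C > 0\<close> S(1,2), of "real D"] t_powr
      by (simp add: m_def D_def)
    moreover have "t powr (1 + \<alpha>) < real D powr (1 + \<alpha>)"
      using D t0 \<open>\<alpha> \<ge> 0\<close> by (intro powr_less_mono2) auto
    ultimately show False by simp
  qed
  moreover have "1 \<le> m powr (\<alpha> / (1 + \<alpha>))" using m1 \<open>\<alpha> \<ge> 0\<close> by (intro ge_one_powr_ge_zero) auto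
  then have "real D \<le> (2 * C powr (1 / (1 + \<alpha>)) + 1) * m powr (\<alpha> / (1 + \<alpha>))"
    using D by (simp add: t_def algebra_simps)
  ultimately show ?thesis by (intro exI[of _ D]) (simp add: D_def m_def)
qed

section \<open>Negative exponents, where the number of edges is bounded\<close>

text \<open>Neighbours of a vertex give distinct edges. This crude bound suffices for \<alpha> <
  0.\<close>

lemma degenerate_card_edges:
  assumes "fin_simple_graph G"
  shows "degenerate (edges G) (card (edges G)) (verts G)"
  unfolding degenerate_def
proof (intro allI impI)
  fix S assume S: "S \<subseteq> verts G" "S \<noteq> {}"
  then obtain x where x: "x \<in> S" by blast
  have "card {y\<in>S. {x, y} \<in> edges G} = card ((\<lambda>y. {x, y}) ` {y\<in>S. {x, y} \<in> edges G})"
    by (rule card_image[symmetric]) (auto simp: inj_on_def doubleton_eq_iff)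
  also have "\<dots> \<le> card (edges G)" using finite_edges[OF assms] by (intro card_mono) auto
  finally show "\<exists>x\<in>S. card {y\<in>S. {x, y} \<in> edges G} \<le> card (edges G)" using x by blast
qed

text \<open>Isolated vertices are dropped, which leaves at most \<open>2 e(G)\<close> vertices. For \<open>\<alpha> < 0\<close> the bound
  is sublinear and caps the number of edges.\<close>
lemma card_edges_le_of_turan:
  fixes G :: "nat graph" and \<alpha> C :: real
  assumes G: "fin_simple_graph G" "graph_free H G"
    and turan: "\<forall>n::nat. n \<ge> 1 \<longrightarrow> real (turan_ex n H) \<le> C * real n powr (1 + \<alpha>)"
    and "C > 0" and m: "card (edges G) \<ge> 1"
  shows "real (card (edges G)) \<le> C * (2 * real (card (edges G))) powr max 0 (1 + \<alpha>)"
proof -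
  define G' where "G' = \<lparr>verts = \<Union>(edges G), edges = edges G\<rparr>"
  have fin: "finite (edges G)" by (rule finite_edges[OF G(1)])
  have V: "\<Union>(edges G) \<subseteq> verts G" using G(1) by (auto simp: fin_simple_graph_def)
  then have simp': "fin_simple_graph G'"
    using G(1) finite_subset[OF V] by (auto simp: fin_simple_graph_def G'_def)
  have sub: "subgraph G' G" using V simp' by (simp add: subgraph_def G'_def)
  have "card (verts G') \<le> (\<Sum>e\<in>edges G. card e)"
    by (simp add: G'_def card_Union_le_sum_card)
  also have "\<dots> = 2 * card (edges G)" using G(1) by (simp add: fin_simple_graph_def)
  finally have n: "card (verts G') \<le> 2 * card (edges G)" .
  obtain e where "e \<in> edges G" using m by (metis card.empty ex_in_conv not_one_le_zero)
  then have "verts G' \<noteq> {}"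
    using G(1) by (fastforce simp: G'_def fin_simple_graph_def)
  then have n1: "card (verts G') \<ge> 1" using simp' by (simp add: fin_simple_graph_def Suc_le_eq card_gt_0_iff)
  have "real (card (edges G)) \<le> real (turan_ex (card (verts G')) H)"
    using card_edges_le_turan_ex[OF simp' graph_free_subgraph[OF G(2) sub]] by (simp add: G'_def)
  also have "\<dots> \<le> C * real (card (verts G')) powr (1 + \<alpha>)" using turan n1 by blast
  \<comment> \<open>For \<open>1 + \<alpha> < 0\<close> the power decreases in its base; the
    exponent is raised to 0 so that the vertex count can be replaced by its upper bound.\<close>
  also have "\<dots> \<le> C * real (card (verts G')) powr max 0 (1 + \<alpha>)"
    using n1 \<open>C > 0\<close> by (intro mult_left_mono powr_mono) auto
  also have "\<dots> \<le> C * (2 * real (card (edges G))) powr max 0 (1 + \<alpha>)"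
    using n \<open>C > 0\<close> by (intro mult_left_mono powr_mono2) auto
  finally show ?thesis .
qed

text \<open>With \<open>\<beta> = max 0 (1 + \<alpha>) < 1\<close>, the inequality
  \<open>m \<le> C * (2 * m) powr \<beta>\<close> can be solved for \<open>m\<close>, with a bound
  independent of \<open>G\<close>.\<close>

lemma card_edges_bounded:
  fixes \<alpha> C :: real
  assumes turan: "\<forall>n::nat. n \<ge> 1 \<longrightarrow> real (turan_ex n H) \<le> C * real n powr (1 + \<alpha>)"
    and "C > 0" "\<alpha> < 0"
  shows "\<exists>M\<ge>1. \<forall>G :: nat graph. fin_simple_graph G \<longrightarrow> graph_free H G \<longrightarrow>
    card (edges G) \<ge> 1 \<longrightarrow> real (card (edges G)) \<le> M"
proof -
  define \<beta> where "\<beta> = max 0 (1 + \<alpha>)"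
  define M where "M = (C * 2 powr \<beta>) powr (1 / (1 - \<beta>))"
  have \<beta>: "0 \<le> \<beta>" "\<beta> < 1" using \<open>\<alpha> < 0\<close> by (auto simp: \<beta>_def)
  have "real (card (edges G)) \<le> M"
    if G: "fin_simple_graph G" "graph_free H G" "card (edges G) \<ge> 1" for G :: "nat graph"
  proof -
    define m where "m = real (card (edges G))"
    have m: "m \<ge> 1" using G by (simp add: m_def)
    have "m \<le> C * (2 * m) powr \<beta>"
      using card_edges_le_of_turan[OF G(1,2) turan \<open>C > 0\<close> G(3)] by (simp add: m_def \<beta>_def)
    then have "m \<le> (C * 2 powr \<beta>) * m powr \<beta>" using m by (simp add: powr_mult mult_ac)
    then have "m powr (1 - \<beta>) \<le> C * 2 powr \<beta>" using m by (simp add: powr_diff field_simps)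
    then have "(m powr (1 - \<beta>)) powr (1 / (1 - \<beta>)) \<le> M"
      unfolding M_def using \<beta> m by (intro powr_mono2) auto
    then show ?thesis using m \<beta> by (simp add: powr_powr m_def)
  qed
  then show ?thesis by (intro exI[of _ "max 1 M"]) fastforce
qed

theorem theorem1p3:
  fixes H :: "'a graph" and \<alpha> C :: real
  assumes "fin_simple_graph H"
    and "\<exists>v\<in>verts H. acyclic_graph (delete_vertex H v)"
    and "C > 0"
    and "\<forall>n::nat. n \<ge> 1 \<longrightarrow> real (turan_ex n H) \<le> C * real n powr (1 + \<alpha>)"
  shows "\<exists>c::real. c > 0 \<and>
    (\<forall>m::nat. m \<ge> 1 \<longrightarrow>
       surplus_min m H \<ge> ereal (c * real m powr ((\<alpha> + 2) / (2 * \<alpha> + 2))))"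
proof -
  obtain v where v: "v \<in> verts H" "acyclic_graph (delete_vertex H v)" using assms(2) by blast
  define q where "q = (\<alpha> + 2) / (2 * \<alpha> + 2)"
  define b where "b = 256 * (real (card (verts H)) + 1)"
  have b: "b > 0" by (simp add: b_def)
  have surplus: "real (card (edges G)) / (b * sqrt D) \<le> surplus G"
    if "fin_simple_graph G" "graph_free H G" "degenerate (edges G) D (verts G)" "D \<ge> 1"
    for G :: "nat graph" and D
    using surplus_ge_of_degenerate[OF that(1,3,4) neighbourhood_degenerate[OF assms(1) v that(1,2)]]
    by (simp add: b_def)
  have "\<exists>c>0. \<forall>G :: nat graph. fin_simple_graph G \<longrightarrow> graph_free H G \<longrightarrow> card (edges G) \<ge> 1 \<longrightarrow>
    c * real (card (edges G)) powr q \<le> surplus G"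
  proof (cases "\<alpha> \<ge> 0")
    case True
    define c where "c = 2 * C powr (1 / (1 + \<alpha>)) + 1"
    have c: "c > 0" unfolding c_def by (intro add_nonneg_pos) auto
    have "1 / (b * sqrt c) * real (card (edges G)) powr q \<le> surplus G"
      if G: "fin_simple_graph G" "graph_free H G" "card (edges G) \<ge> 1" for G :: "nat graph"
    proof -
      define m where "m = real (card (edges G))"
      have m: "m \<ge> 1" using G by (simp add: m_def)
      obtain D where D: "D \<ge> 1" "degenerate (edges G) D (verts G)"
        "real D \<le> c * m powr (\<alpha> / (1 + \<alpha>))"
        using free_graph_degenerate[OF G(1,2) assms(4) True assms(3) G(3)] unfolding c_def m_def by blast
      \<comment> \<open>Substituting the degeneracy bound into \<open>m / (b * sqrt D)\<close>
        produces exactly the exponent \<open>q\<close>.\<close>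
      have "sqrt D \<le> sqrt (c * m powr (\<alpha> / (1 + \<alpha>)))" using D by simp
      also have "\<dots> = sqrt c * m powr (\<alpha> / (1 + \<alpha>) / 2)"
        using m by (simp add: real_sqrt_mult powr_half_sqrt[symmetric] powr_powr del: powr_half_sqrt)
      finally have "m / (b * (sqrt c * m powr (\<alpha> / (1 + \<alpha>) / 2))) \<le> m / (b * sqrt D)"
        using m b D(1) c by (intro divide_left_mono mult_left_mono mult_pos_pos) auto
      also have "\<dots> \<le> surplus G" using surplus[OF G(1,2) D(2,1)] by (simp add: m_def)
      also have "m / (b * (sqrt c * m powr (\<alpha> / (1 + \<alpha>) / 2))) = 1 / (b * sqrt c) * m powr (1 - \<alpha> / (1 + \<alpha>) / 2)"
        using m by (simp add: powr_diff)
      also have "1 - \<alpha> / (1 + \<alpha>) / 2 = q" using True by (simp add: q_def field_simps)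
      finally show ?thesis by (simp add: m_def)
    qed
    then show ?thesis using b c by (intro exI[of _ "1 / (b * sqrt c)"]) auto
  next
    case False
    then obtain M where M: "M \<ge> 1" "\<And>G :: nat graph. fin_simple_graph G \<Longrightarrow> graph_free H G \<Longrightarrow>
      card (edges G) \<ge> 1 \<Longrightarrow> real (card (edges G)) \<le> M"
      using card_edges_bounded[OF assms(4,3)] by (meson not_le)
    \<comment> \<open>Here \<open>q\<close> can have either sign, and division by zero makes it 0 at
      \<open>\<alpha> = -1\<close>; the absolute value covers every case. As
      \<open>m \<le> M\<close>, a positive constant lower bound for the surplus is enough.\<close>
    have "1 / (b * M powr \<bar>q\<bar>) * real (card (edges G)) powr q \<le> surplus G"
      if G: "fin_simple_graph G" "graph_free H G" "card (edges G) \<ge> 1" for G :: "nat graph"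
    proof -
      define m where "m = real (card (edges G))"
      have m: "1 \<le> m" "m \<le> M" using G M(2) by (auto simp: m_def)
      have "m powr q \<le> m powr \<bar>q\<bar>" using m by (intro powr_mono) auto
      also have "\<dots> \<le> M powr \<bar>q\<bar>" using m by (intro powr_mono2) auto
      finally have "1 / (b * M powr \<bar>q\<bar>) * m powr q \<le> 1 / b"
        using b M(1) by (simp add: field_simps)
      also have "\<dots> \<le> m / (b * sqrt m)"
      proof -
        have "sqrt m * 1 \<le> sqrt m * sqrt m" using m by (intro mult_left_mono) auto
        then show ?thesis using m b by (simp add: field_simps)
      qed
      also have "\<dots> \<le> surplus G"
        using surplus[OF G(1,2) degenerate_card_edges[OF G(1)] G(3)] by (simp add: m_def)
      finally show ?thesis by (simp add: m_def)
    qed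
    then show ?thesis using b M(1) by (intro exI[of _ "1 / (b * M powr \<bar>q\<bar>)"]) auto
  qed
  then obtain c where c: "c > 0" "\<And>G :: nat graph. fin_simple_graph G \<Longrightarrow> graph_free H G \<Longrightarrow>
    card (edges G) \<ge> 1 \<Longrightarrow> c * real (card (edges G)) powr q \<le> surplus G" by blast
  \<comment> \<open>Bounding every member also covers the case without an \<open>H\<close>-free
    graph on \<open>m\<close> edges, where the infimum is infinite.\<close>
  have "ereal (c * real m powr q) \<le> surplus_min m H" if "m \<ge> 1" for m
    unfolding surplus_min_def using that c(2) by (intro Inf_greatest) auto
  then show ?thesis using c(1) unfolding q_def by blast
qed

end
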